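(* Let $\mathbb{K}$ be an infinite field. A mapping $\psi:\mathrm{evC}\to\mathbb{K}$ is a polynomial invariant if and only if there is a finite $\mathbb{K}$-linear combination $\mathbf{w}$ of matrix compositions in $\mathrm{Cmp}(\mathbb{N}_0)$ such that $$\psi(X)=\langle\mathsf{SS}(\delta X),\mathbf{w}\rangle\quad\text{for all }X\in\mathrm{evC}.$$
   Context: $\mathbb{N}=\{1,2,\ldots\}$, $\mathbb{N}_0=\{0\}\cup\mathbb{N}$; $\mathbb{N}^2$ carries the product order. $\mathrm{evC}$ is the $\mathbb{K}$-module of eventually constant functions $X:\mathbb{N}^2\to\mathbb{K}$, i.e. those for which there is $\boldsymbol{n}\in\mathbb{N}^2$ such that $X$ is constant on $\{\boldsymbol{i}\in\mathbb{N}^2\mid\boldsymbol{i}\not\leq\boldsymbol{n}\}$. $\mathrm{evZ}\subseteq\mathrm{evC}$ is the submodule of functions of finite support. For $(a,k)\in\{1,2\}\times\mathbb{N}$, $\mathsf{warp}_{a,k}:\mathrm{evC}\to\mathrm{evC}$ is $(\mathsf{warp}_{a,k}X)_{\boldsymbol{i}}=X_{\boldsymbol{i}}$ if $\boldsymbol{i}_a\leq k$ and $X_{\boldsymbol{i}-e_a}$ if $\boldsymbol{i}_a>k$. The difference operator $\delta:\mathrm{evC}\to\mathrm{evZ}$ is $(\delta X)_{i,j}=X_{i+1,j+1}-X_{i+1,j}-X_{i,j+1}+X_{i,j}$. Let $(x_{\boldsymbol{i}})_{\boldsymbol{i}\in\mathbb{N}^2}$ be commuting variables and $\mathbb{K}[[x]]_{<\infty}$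 the $\mathbb{K}$-algebra of formal power series in $x$ of finite degree. Every $f\in\mathbb{K}[[x]]_{<\infty}$ is evaluated at $X\in\mathrm{evZ}$ by substituting $x_{\boldsymbol{i}}\mapsto X_{\boldsymbol{i}}$ (only finitely many monomials contribute), giving $f(X)\in\mathbb{K}$. A mapping $\psi:\mathrm{evC}\to\mathbb{K}$ is a polynomial invariant if (1) it is invariant modulo constants: $\psi(X+C)=\psi(X)$ for all $X\in\mathrm{evC}$ and all constant functions $C$; (2) it is invariant to warping (in both directions independently): $\psi\circ\mathsf{warp}_{a,k}=\psi$ for all $(a,k)\in\{1,2\}\times\mathbb{N}$; (3) there is $f\in\mathbb{K}[[x]]_{<\infty}$ with $\psi(X)=f(X)$ for all $X\in\mathrm{evZ}$. $\mathrm{Cmp}(\mathbb{N}_0)$ is the set of all matrices with entries in $\mathbb{N}_0$ (with at least one row and column) having no zero row and no zero column, together with the empty composition $\mathsf{e}$. For $Z\in\mathrm{evZ}$, $\langle\mathsf{SS}(Z),\mathsf{e}\rangle=1$ and for $\mathbf{a}\in\mathrm{Cmp}(\mathbb{N}_0)$ of size $m\times n$, $$\langle\mathsf{SS}(Z),\mathbf{a}\rangle=\sum_{\substack{1\leq\iota_1<\cdots<\iota_m\\1\leq\kappa_1<\cdots<\kappa_n}}\ \prod_{s=1}^{m}\prod_{t=1}^{n}Z_{\iota_s,\kappa_t}^{\mathbf{a}_{s,t}},$$ extended linearly in $\mathbf{a}$ to finite linear combinations. *)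

theory Defs
  imports
    "HOL-Library.Multiset"
    "HOL-Library.Product_Order"
    "HOL-Library.Poly_Mapping"
    "Jordan_Normal_Form.Matrix"
begin

text \<open>
  Index convention: the positive integers \<open>1, 2, \<dots>\<close>, used as positions (and as warping positions),
  are represented by the type \<^typ>\<open>nat\<close> through the order isomorphism \<open>n \<mapsto> n + 1\<close>.  Thus
  \<^typ>\<open>nat \<times> nat\<close> with the product order stands for the index set of all functions below, and a
  position \<open>k \<ge> 1\<close> appears as \<open>k - 1\<close>.  All defining formulas only compare and shift
  positions, hence keep their shape.

  Possibly infinite sums with only finitely many non-zero terms are written with \<^const>\<open>sum'\<close>.
\<close>

type_synonym 'k plane = "nat \<times> nat \<Rightarrow> 'k"

definition evC :: "'k plane set" where
  "evC = {X. \<exists>n c. \<forall>i. \<not> i \<le> n \<longrightarrow> X i = c}"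

definition evZ :: "'k::zero plane set" where
  "evZ = {X \<in> evC. finite {i. X i \<noteq> 0}}"

text \<open>The axis \<open>a\<close> is 1 or 2.\<close>

definition warp :: "nat \<Rightarrow> nat \<Rightarrow> 'k plane \<Rightarrow> 'k plane" where
  "warp a k X = (\<lambda>(i, j).
     if a = 1 then (if i \<le> k then X (i, j) else X (i - 1, j))
     else (if j \<le> k then X (i, j) else X (i, j - 1)))"

definition delta :: "'k::ab_group_add plane \<Rightarrow> 'k plane" where
  "delta X = (\<lambda>(i, j). X (i + 1, j + 1) - X (i + 1, j) - X (i, j + 1) + X (i, j))"

text \<open>
  A monomial in the variables \<open>x\<^sub>i\<close> is a finite multiset of indices (with \<^const>\<open>size\<close> its degree), and
  a formal power series is the family of its coefficients.
\<close>

type_synonym 'k power_series = "(nat \<times> nat) multiset \<Rightarrow> 'k"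

definition finite_degree :: "'k::zero power_series \<Rightarrow> bool" where
  "finite_degree f \<longleftrightarrow> (\<exists>d. \<forall>m. f m \<noteq> 0 \<longrightarrow> size m \<le> d)"

definition eval_series :: "'k::comm_semiring_1 power_series \<Rightarrow> 'k plane \<Rightarrow> 'k" where
  "eval_series f X = sum' (\<lambda>m. f m * (\<Prod>i\<in>#m. X i)) UNIV"

text \<open>
  A map on \<^const>\<open>evC\<close> is a total function whose values off \<^const>\<open>evC\<close> are never inspected.
\<close>

definition polynomial_invariant :: "('k::comm_ring_1 plane \<Rightarrow> 'k) \<Rightarrow> bool" where
  "polynomial_invariant \<psi> \<longleftrightarrow>
     (\<forall>X\<in>evC. \<forall>c. \<psi> (\<lambda>i. X i + c) = \<psi> X) \<and>
     (\<forall>a\<in>{1, 2}. \<forall>k. \<forall>X\<in>evC. \<psi> (warp a k X) = \<psi> X) \<and>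
     (\<exists>f. finite_degree f \<and> (\<forall>X\<in>evZ. \<psi> X = eval_series f X))"

definition empty_comp :: "nat mat" where
  "empty_comp = 0\<^sub>m 0 0"

definition Cmp :: "nat mat set" where
  "Cmp = insert empty_comp
     {A. dim_row A \<ge> 1 \<and> dim_col A \<ge> 1 \<and>
         (\<forall>s<dim_row A. row A s \<noteq> 0\<^sub>v (dim_col A)) \<and>
         (\<forall>t<dim_col A. col A t \<noteq> 0\<^sub>v (dim_row A))}"

definition increasing_tuples :: "nat \<Rightarrow> nat list set" where
  "increasing_tuples m = {\<iota>. length \<iota> = m \<and> sorted_wrt (<) \<iota>}"

definition SS :: "'k::comm_semiring_1 plane \<Rightarrow> nat mat \<Rightarrow> 'k" where
  "SS Z A =
     (if A = empty_comp then 1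
      else sum' (\<lambda>(\<iota>, \<kappa>). \<Prod>s<dim_row A. \<Prod>t<dim_col A. Z (\<iota> ! s, \<kappa> ! t) ^ (A $$ (s, t)))
             (increasing_tuples (dim_row A) \<times> increasing_tuples (dim_col A)))"

definition SS_lin :: "'k::comm_semiring_1 plane \<Rightarrow> (nat mat \<Rightarrow>\<^sub>0 'k) \<Rightarrow> 'k" where
  "SS_lin Z w = (\<Sum>A\<in>Poly_Mapping.keys w. Poly_Mapping.lookup w A * SS Z A)"

text \<open>
  The operators have the intended codomains, and the sums above are finite (so that \<^const>\<open>sum'\<close>
  never takes its default value \<open>0\<close>).
\<close>

lemma warp_evC:
  assumes "X \<in> evC"
  shows "warp a k X \<in> evC"
proof -
  from assms obtain n1 n2 c where X: "\<And>i. \<not> i \<le> (n1, n2) \<Longrightarrow> X i = c"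
    unfolding evC_def by fastforce
  have "warp a k X i = c" if "\<not> i \<le> (n1 + 1, n2 + 1)" for i
    using that by (cases i) (auto simp: warp_def intro!: X)
  then show ?thesis
    unfolding evC_def by blast
qed

lemma delta_evZ:
  assumes "X \<in> evC"
  shows "delta X \<in> evZ"
proof -
  from assms obtain n1 n2 c where X: "\<And>i. \<not> i \<le> (n1, n2) \<Longrightarrow> X i = c"
    unfolding evC_def by fastforce
  have D: "delta X i = 0" if "\<not> i \<le> (n1, n2)" for i
  proof (cases i)
    case (Pair i1 i2)
    with that have "X (i1 + 1, i2 + 1) = c" "X (i1, i2) = c"
      "X (i1 + 1, i2) = c" "X (i1, i2 + 1) = c"
      by (auto intro!: X)
    then show ?thesis
      using Pair by (simp add: delta_def)
  qed
  then have "{i. delta X i \<noteq> 0} \<subseteq> {..n1} \<times> {..n2}"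
    by (auto simp: less_eq_prod_def)
       (metis fst_conv snd_conv less_eq_prod_def)+
  then have "finite {i. delta X i \<noteq> 0}"
    by (rule finite_subset) simp
  with D show ?thesis
    unfolding evZ_def evC_def by blast
qed

lemma eval_series_finite:
  fixes f :: "'k::comm_semiring_1 power_series"
  assumes "finite_degree f" and "X \<in> evZ"
  shows "finite {m. f m * (\<Prod>i\<in>#m. X i) \<noteq> 0}"
proof -
  obtain d where d: "\<And>m. f m \<noteq> 0 \<Longrightarrow> size m \<le> d"
    using assms(1) unfolding finite_degree_def by blast
  let ?S = "{i. X i \<noteq> 0}"
  have S: "finite ?S"
    using assms(2) unfolding evZ_def by blast
  have "{m. f m * (\<Prod>i\<in>#m. X i) \<noteq> 0} \<subseteq> mset ` {xs. set xs \<subseteq> ?S \<and> length xs \<le> d}"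
  proof
    fix m assume "m \<in> {m. f m * (\<Prod>i\<in>#m. X i) \<noteq> 0}"
    then have f: "f m \<noteq> 0" and p: "(\<Prod>i\<in>#m. X i) \<noteq> 0"
      by auto
    obtain xs where xs: "mset xs = m"
      using ex_mset by blast
    have "set_mset m \<subseteq> ?S"
    proof
      fix i assume "i \<in># m"
      then obtain m' where "m = add_mset i m'"
        by (blast dest: multi_member_split)
      with p show "i \<in> ?S"
        by auto
    qed
    with xs d[OF f] show "m \<in> mset ` {xs. set xs \<subseteq> ?S \<and> length xs \<le> d}"
      by (intro image_eqI[of _ _ xs]) auto
  qed
  then show ?thesis
    by (rule finite_subset) (simp add: finite_lists_length_le S)
qed

lemma SS_finite:
  fixes Z :: "'k::comm_semiring_1 plane"
  assumes "Z \<in> evZ" and "A \<in> Cmp"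
  shows "finite {(\<iota>, \<kappa>) \<in> increasing_tuples (dim_row A) \<times> increasing_tuples (dim_col A).
    (\<Prod>s<dim_row A. \<Prod>t<dim_col A. Z (\<iota> ! s, \<kappa> ! t) ^ (A $$ (s, t))) \<noteq> 0}"
    (is "finite ?T")
proof -
  let ?S = "{i. Z i \<noteq> 0}"
  have S: "finite ?S"
    using assms(1) unfolding evZ_def by blast
  have rows: "\<exists>t<dim_col A. A $$ (s, t) \<noteq> 0" if "s < dim_row A" for s
    using assms(2) that by (fastforce simp: Cmp_def empty_comp_def)
  have cols: "\<exists>s<dim_row A. A $$ (s, t) \<noteq> 0" if "t < dim_col A" for t
    using assms(2) that by (fastforce simp: Cmp_def empty_comp_def)
  have "?T \<subseteq> {\<iota>. set \<iota> \<subseteq> fst ` ?S \<and> length \<iota> = dim_row A} \<times>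
             {\<kappa>. set \<kappa> \<subseteq> snd ` ?S \<and> length \<kappa> = dim_col A}"
  proof
    fix p
    assume "p \<in> ?T"
    then obtain \<iota> \<kappa> where eq: "p = (\<iota>, \<kappa>)"
      and len: "\<iota> \<in> increasing_tuples (dim_row A)" "\<kappa> \<in> increasing_tuples (dim_col A)"
      and nonzero: "(\<Prod>s<dim_row A. \<Prod>t<dim_col A. Z (\<iota> ! s, \<kappa> ! t) ^ (A $$ (s, t))) \<noteq> 0"
      by auto
    have nz: "(\<iota> ! s, \<kappa> ! t) \<in> ?S"
      if st: "s < dim_row A" "t < dim_col A" "A $$ (s, t) \<noteq> 0" for s t
    proof (rule ccontr)
      assume "(\<iota> ! s, \<kappa> ! t) \<notin> ?S"
      with st(3) have "Z (\<iota> ! s, \<kappa> ! t) ^ (A $$ (s, t)) = 0"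
        by (simp add: power_0_left)
      then have "(\<Prod>t<dim_col A. Z (\<iota> ! s, \<kappa> ! t) ^ (A $$ (s, t))) = 0"
        using st(2) by (intro prod_zero) auto
      then have "(\<Prod>s<dim_row A. \<Prod>t<dim_col A. Z (\<iota> ! s, \<kappa> ! t) ^ (A $$ (s, t))) = 0"
        using st(1) by (intro prod_zero) auto
      with nonzero show False by simp
    qed
    have l: "length \<iota> = dim_row A" "length \<kappa> = dim_col A"
      using len by (auto simp: increasing_tuples_def)
    have "set \<iota> \<subseteq> fst ` ?S"
      unfolding subset_iff in_set_conv_nth using rows nz l(1) by (metis fst_conv imageI)
    moreover have "set \<kappa> \<subseteq> snd ` ?S"
      unfolding subset_iff in_set_conv_nth using cols nz l(2) by (metis snd_conv imageI)
    ultimately show "p \<in> {\<iota>. set \<iota> \<subseteq> fst ` ?S \<and> length \<iota> = dim_row A} \<times>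
        {\<kappa>. set \<kappa> \<subseteq> snd ` ?S \<and> length \<kappa> = dim_col A}"
      using l eq by blast
  qed
  then show ?thesis
    by (rule finite_subset) (intro finite_cartesian_product finite_lists_length_eq finite_imageI S)
qed

end

theory Submission
  imports Defs "HOL-Computational_Algebra.Polynomial"
begin

text \<open>
  Call two functions equivalent if they differ by a constant. On eventually constant functions,
  \<^const>\<open>delta\<close> is a bijection from equivalence classes to functions of finite support; its inverse sums
  over upper right quadrants (\<open>delta_integ\<close>, \<open>evC_eq_integ_delta_plus_const\<close>). Under this bijection,
  warping a function at \<open>k\<close>, which repeats its row (or column) \<open>k\<close>, becomes the insertion of a zero row
  (or column) at \<open>k\<close> (\<open>delta_warp\<close>). A polynomial invariant is therefore the same as a function of
  the differences that is unaffected by insertion of zeros and is given by a series of finite degree.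

  That polynomiality in \<open>X\<close> and polynomiality in \<open>delta X\<close> are equivalent is clear on each finite box, where
  both changes of variables are linear. Over an infinite field a polynomial function determines its
  coefficients, so the polynomials obtained on growing boxes are restrictions of one another and glue
  to a single series of finite degree (\<open>boxwise_poly_fun_eval_series\<close>, \<open>eval_series_substitute\<close>).

  The same uniqueness turns invariance of the values under insertion of zeros into a symmetry of the
  coefficients: the coefficient of a monomial does not change when its variables move along an
  insertion (\<open>warp_invariant_series_shift_invariant\<close>). Such moves can close all gaps between
  the occupied rows and columns, after which the monomial is described by its matrix of exponents, a
  matrix composition. Hence the symmetric series are exactly those whose coefficients factor through
  the composition of a monomial (\<open>gap_free_representative\<close>,
  \<open>shift_invariant_series_factors\<close>). Finally, the coefficient of the signature at \<open>A\<close> is the sum of all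
  monomials with composition \<open>A\<close>, one for each choice of rows and columns
  (\<open>SS_eq_sum_monomials\<close>), so these series are the linear combinations of signature coefficients.
  Read backwards, the same chain of equivalences shows that each such combination is an invariant.
\<close>

section \<open>Evaluation of power series of finite degree\<close>

abbreviation monomial :: "'a multiset \<Rightarrow> ('a \<Rightarrow> 'k::comm_semiring_1) \<Rightarrow> 'k" where
  "monomial m Z \<equiv> (\<Prod>i\<in>#m. Z i)"

text \<open>
Series and planes involve infinitely many variables, but every function of finite support lives on
some square \<open>box N\<close>, where a series of finite degree is an ordinary polynomial in \<open>N\<^sup>2\<close> variables.
\<close>

definition box :: "nat \<Rightarrow> (nat \<times> nat) set" where
  "box N = {..<N} \<times> {..<N}"

definition supported_in :: "nat \<Rightarrow> 'k::zero plane set" where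
  "supported_in N = {Z. \<forall>i. i \<notin> box N \<longrightarrow> Z i = 0}"

definition monomials_upto :: "nat \<Rightarrow> nat \<Rightarrow> (nat \<times> nat) multiset set" where
  "monomials_upto N d = {m. set_mset m \<subseteq> box N \<and> size m \<le> d}"

lemma finite_box [simp]: "finite (box N)"
  by (simp add: box_def)

lemma box_mono: "N \<le> M \<Longrightarrow> box N \<subseteq> box M"
  by (auto simp: box_def)

lemma supported_in_mono: "N \<le> M \<Longrightarrow> supported_in N \<subseteq> supported_in M"
  using box_mono by (fastforce simp: supported_in_def)

lemma finite_set_subset_box:
  assumes "finite S"
  obtains N where "S \<subseteq> box N"
proof -
  obtain M where "\<forall>k\<in>fst ` S \<union> snd ` S. k < M"
    using finite_nat_set_iff_bounded[of "fst ` S \<union> snd ` S"] assms by blast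
  then have "S \<subseteq> box M"
    by (force simp: box_def)
  then show thesis
    by (rule that)
qed

lemma supported_in_evZ: "supported_in N \<subseteq> (evZ :: 'k::zero plane set)"
proof
  fix Z :: "'k plane"
  assume Z: "Z \<in> supported_in N"
  then have "Z i = 0" if "\<not> i \<le> (N, N)" for i
    using that by (cases i) (auto simp: supported_in_def box_def)
  moreover have "finite {i. Z i \<noteq> 0}"
    using Z by (intro finite_subset[OF _ finite_box[of N]]) (auto simp: supported_in_def)
  ultimately show "Z \<in> evZ"
    unfolding evZ_def evC_def by blast
qed

lemma evZ_supported:
  assumes "Z \<in> evZ"
  obtains N where "Z \<in> supported_in N"
proof -
  from assms obtain N where "{i. Z i \<noteq> 0} \<subseteq> box N"
    unfolding evZ_def using finite_set_subset_box by auto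
  then show thesis
    by (intro that[of N]) (auto simp: supported_in_def)
qed

lemma finite_monomials_upto [simp]: "finite (monomials_upto N d)"
proof (rule finite_subset)
  show "monomials_upto N d \<subseteq> mset ` {xs. set xs \<subseteq> box N \<and> length xs \<le> d}"
  proof
    fix m assume m: "m \<in> monomials_upto N d"
    obtain xs where xs: "mset xs = m"
      using ex_mset by blast
    have "set xs = set_mset m" "length xs = size m"
      unfolding xs[symmetric] by simp_all
    with m have "set xs \<subseteq> box N" "length xs \<le> d"
      by (simp_all add: monomials_upto_def)
    with xs show "m \<in> mset ` {xs. set xs \<subseteq> box N \<and> length xs \<le> d}"
      by blast
  qed
qed (simp add: finite_lists_length_le)

lemma monomial_zero:
  assumes "i \<in># m" "Z i = 0"
  shows "monomial m Z = 0"
  using assms by (auto dest!: multi_member_split)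

lemma monomial_supported_zero:
  assumes "Z \<in> supported_in N" "\<not> set_mset m \<subseteq> box N"
  shows "monomial m Z = 0"
  using assms by (auto simp: supported_in_def intro: monomial_zero)

lemma eval_series_supported:
  fixes f :: "'k::comm_semiring_1 power_series"
  assumes "\<And>m. f m \<noteq> 0 \<Longrightarrow> size m \<le> d" and Z: "Z \<in> supported_in N"
  shows "eval_series f Z = (\<Sum>m\<in>monomials_upto N d. f m * monomial m Z)"
proof -
  have "f m * monomial m Z = 0" if "m \<notin> monomials_upto N d" for m
  proof (cases "f m = 0")
    case False
    with that assms(1) have "\<not> set_mset m \<subseteq> box N"
      by (auto simp: monomials_upto_def)
    then show ?thesis
      by (simp add: monomial_supported_zero[OF Z])
  qed simp
  then have "eval_series f Z = sum' (\<lambda>m. f m * monomial m Z) (monomials_upto N d)"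
    unfolding eval_series_def by (intro sum.mono_neutral_right') auto
  then show ?thesis
    by simp
qed

section \<open>Uniqueness of the coefficients over an infinite field\<close>

text \<open>
  Separating one variable \<open>b\<close> turns the sum into a univariate polynomial in the value at \<open>b\<close> which has
  infinitely many roots; its coefficients are sums of the same kind in one variable less.
\<close>

lemma monomial_coefficients_zero:
  fixes c :: "'a multiset \<Rightarrow> 'k::field"
  assumes inf: "infinite (UNIV :: 'k set)"
    and "finite B" "finite S" "\<forall>m\<in>S. set_mset m \<subseteq> B"
    and "\<forall>Z. (\<Sum>m\<in>S. c m * monomial m Z) = 0"
    and "m \<in> S"
  shows "c m = 0"
  using assms(2-)
proof (induction B arbitrary: S c m rule: finite_induct)
  case empty
  then have "S = {{#}}"
    by auto
  with empty show ?case
    by simp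
next
  case (insert b B S c m0)
  let ?rest = "filter_mset (\<lambda>x. x \<noteq> b)"
  define k where "k = count m0 b"
  define T where "T = {m \<in> S. count m b = k}"
  have split: "m = replicate_mset (count m b) b + ?rest m" for m
    by (rule multiset_eqI) auto
  have coeff_zero: "(\<Sum>m\<in>T. c m * monomial (?rest m) Z) = 0" for Z :: "'a \<Rightarrow> 'k"
  proof -
    define p where "p = (\<Sum>m\<in>S. monom (c m * monomial (?rest m) Z) (count m b))"
    have "poly p z = 0" for z
    proof -
      let ?Z = "Z(b := z)"
      \<comment> \<open>The exponent of \<open>b\<close> splits off as a power of \<open>z\<close>; the rest of the monomial ignores \<open>z\<close>.\<close>
      have "monomial m ?Z = z ^ count m b * monomial (?rest m) Z" for m
      proof -
        have "monomial m ?Z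
            = monomial (replicate_mset (count m b) b) ?Z * monomial (?rest m) ?Z"
          by (subst split) (simp only: image_mset_union prod_mset_Un)
        also have "image_mset ?Z (?rest m) = image_mset Z (?rest m)"
          by (rule image_mset_cong) auto
        finally show ?thesis
          by simp
      qed
      then have "poly p z = (\<Sum>m\<in>S. c m * monomial m ?Z)"
        by (simp add: p_def poly_sum poly_monom mult_ac)
      with insert.prems(3) show ?thesis
        by simp
    qed
    with inf poly_roots_finite[of p] have "p = 0"
      by auto
    have "(\<Sum>m\<in>T. c m * monomial (?rest m) Z) = coeff p k"
      using insert.prems(1)
      by (simp add: p_def T_def coeff_sum when_def flip: sum.inter_filter)
    with \<open>p = 0\<close> show ?thesis
      by simp
  qed
  have inj: "inj_on ?rest T"
    using split by (intro inj_onI) (metis (mono_tags, lifting) T_def mem_Collect_eq)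
  \<comment> \<open>Among monomials with the same exponent of \<open>b\<close>, removing \<open>b\<close> is injective, so the coefficients
    can be carried over.\<close>
  define c' where "c' = c \<circ> the_inv_into T ?rest"
  have c': "c' (?rest m) = c m" if "m \<in> T" for m
    using that inj by (simp add: c'_def the_inv_into_f_f)
  have "c' (?rest m0) = 0"
  proof (rule insert.IH)
    show "finite (?rest ` T)" "\<forall>m\<in>?rest ` T. set_mset m \<subseteq> B"
      using insert.prems(1,2) by (auto simp: T_def)
    show "\<forall>Z. (\<Sum>m\<in>?rest ` T. c' m * monomial m Z) = 0"
      using coeff_zero by (simp add: sum.reindex[OF inj] c')
    show "?rest m0 \<in> ?rest ` T"
      using insert.prems(4) by (simp add: T_def k_def)
  qed
  then show ?case
    using c'[of m0] insert.prems(4) by (simp add: T_def k_def)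
qed

lemma supported_coefficients_unique:
  fixes c :: "'k::field power_series"
  assumes inf: "infinite (UNIV :: 'k set)"
    and eq: "\<And>Z. Z \<in> supported_in N \<Longrightarrow>
      (\<Sum>m\<in>monomials_upto N d. c m * monomial m Z) = (\<Sum>m\<in>monomials_upto N d. c' m * monomial m Z)"
    and m: "m \<in> monomials_upto N d"
  shows "c m = c' m"
proof -
  have "c m - c' m = 0"
  proof (rule monomial_coefficients_zero[OF inf finite_box[of N] finite_monomials_upto _ _ m])
    show "\<forall>m\<in>monomials_upto N d. set_mset m \<subseteq> box N"
      by (simp add: monomials_upto_def)
    show "\<forall>Z. (\<Sum>m\<in>monomials_upto N d. (c m - c' m) * monomial m Z) = 0"
    proof
      fix Z :: "'k plane"
      define Z' where "Z' = (\<lambda>i. if i \<in> box N then Z i else 0)"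
      have Z': "Z' \<in> supported_in N"
        by (simp add: supported_in_def Z'_def)
      have "monomial m Z = monomial m Z'" if "m \<in> monomials_upto N d" for m
        using that
        by (intro arg_cong[of _ _ prod_mset] image_mset_cong) (auto simp: Z'_def monomials_upto_def)
      then show "(\<Sum>m\<in>monomials_upto N d. (c m - c' m) * monomial m Z) = 0"
        using eq[OF Z'] by (simp add: left_diff_distrib sum_subtractf)
    qed
  qed
  then show ?thesis
    by simp
qed

lemma finite_degree_common_bound:
  assumes "finite_degree f" "finite_degree g"
  obtains d where "\<And>m. f m \<noteq> 0 \<Longrightarrow> size m \<le> d" "\<And>m. g m \<noteq> 0 \<Longrightarrow> size m \<le> d"
proof -
  from assms obtain d e where "\<And>m. f m \<noteq> 0 \<Longrightarrow> size m \<le> d" "\<And>m. g m \<noteq> 0 \<Longrightarrow> size m \<le> e"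
    unfolding finite_degree_def by blast
  then show thesis
    by (intro that[of "max d e"]) (auto simp: le_max_iff_disj)
qed

text \<open>
Each monomial lies in some box, and there it can be tested against ordinary polynomials.
\<close>

lemma eval_series_unique:
  fixes f g :: "'k::field power_series"
  assumes inf: "infinite (UNIV :: 'k set)"
    and "finite_degree f" "finite_degree g"
    and eq: "\<And>Z. Z \<in> evZ \<Longrightarrow> eval_series f Z = eval_series g Z"
  shows "f = g"
proof
  fix m
  obtain d where d: "\<And>m. f m \<noteq> 0 \<Longrightarrow> size m \<le> d" "\<And>m. g m \<noteq> 0 \<Longrightarrow> size m \<le> d"
    using finite_degree_common_bound[OF assms(2,3)] by metis
  obtain N where N: "set_mset m \<subseteq> box N"
    using finite_set_subset_box by blast
  show "f m = g m"
  proof (cases "size m \<le> d")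
    case True
    show ?thesis
    proof (rule supported_coefficients_unique[OF inf, where c = f and c' = g and N = N and d = d])
      fix Z :: "'k plane"
      assume Z: "Z \<in> supported_in N"
      then show "(\<Sum>m\<in>monomials_upto N d. f m * monomial m Z)
          = (\<Sum>m\<in>monomials_upto N d. g m * monomial m Z)"
        using eval_series_supported[where f = f, OF d(1)] eval_series_supported[where f = g, OF d(2)]
          eq[of Z] supported_in_evZ[of N] by (metis subsetD)
    qed (use N True in \<open>simp add: monomials_upto_def\<close>)
  next
    case False
    with d show ?thesis
      by metis
  qed
qed

section \<open>Functions that are polynomial on every box\<close>

text \<open>
Polynomial functions of degree at most \<open>d\<close>, as the linear span of the monomial functions. Generating
them this way keeps products and substitutions free of any bookkeeping with coefficients.
\<close>

inductive poly_fun :: "nat \<Rightarrow> (('a \<Rightarrow> 'k::comm_ring_1) \<Rightarrow> 'k) \<Rightarrow> bool" for d where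
  monomial: "size m \<le> d \<Longrightarrow> poly_fun d (\<lambda>Z. c * monomial m Z)"
| add: "poly_fun d F \<Longrightarrow> poly_fun d G \<Longrightarrow> poly_fun d (\<lambda>Z. F Z + G Z)"

lemma poly_fun_const: "poly_fun d (\<lambda>Z. c)"
  using poly_fun.monomial[of "{#}" d c] by simp

lemma poly_fun_sum:
  assumes "\<And>i. i \<in> I \<Longrightarrow> poly_fun d (F i)"
  shows "poly_fun d (\<lambda>Z. \<Sum>i\<in>I. F i Z)"
  using assms
proof (induction I rule: infinite_finite_induct)
  case (insert i I)
  then have "poly_fun d (\<lambda>Z. F i Z + (\<Sum>i\<in>I. F i Z))"
    by (intro poly_fun.add) simp_all
  with insert show ?case
    by simp
qed (simp_all add: poly_fun_const)

lemma poly_fun_monomial_mult: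
  assumes "poly_fun e G" "size m \<le> d"
  shows "poly_fun (d + e) (\<lambda>Z. c * monomial m Z * G Z)"
  using assms(1)
proof induction
  case (monomial n c')
  then have "poly_fun (d + e) (\<lambda>Z. (c * c') * monomial (m + n) Z)"
    using assms(2) by (intro poly_fun.monomial) simp
  then show ?case
    by (simp add: mult_ac)
next
  case (add F G)
  then show ?case
    by (simp add: distrib_left poly_fun.add)
qed

lemma poly_fun_mult:
  assumes "poly_fun d F" "poly_fun e G"
  shows "poly_fun (d + e) (\<lambda>Z. F Z * G Z)"
  using assms(1)
proof induction
  case (monomial m c)
  then show ?case
    using assms(2) by (intro poly_fun_monomial_mult)
next
  case (add F G)
  then show ?case
    by (simp add: distrib_right poly_fun.add)
qed

lemma poly_fun_degree_mono:
  assumes "poly_fun d F" "d \<le> e"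
  shows "poly_fun e F"
  using assms(1)
proof induction
  case (monomial m c)
  then show ?case
    using assms(2) by (intro poly_fun.monomial) simp
qed (rule poly_fun.add)

lemma poly_fun_monomial_substitute:
  assumes "\<And>i. poly_fun 1 (\<lambda>Z. L Z i)"
  shows "poly_fun (size m) (\<lambda>Z. monomial m (L Z))"
proof (induction m)
  case empty
  show ?case
    by (simp add: poly_fun_const)
next
  case (add i m)
  then show ?case
    using poly_fun_mult[OF assms[of i] add] by simp
qed

lemma poly_fun_substitute:
  assumes "poly_fun d F" and L: "\<And>i. poly_fun 1 (\<lambda>Z. L Z i)"
  shows "poly_fun d (\<lambda>Z. F (L Z))"
  using assms(1)
proof induction
  case (monomial m c)
  have "poly_fun (0 + size m) (\<lambda>Z. c * monomial m (L Z))"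
    by (intro poly_fun_mult poly_fun_const poly_fun_monomial_substitute L)
  then show ?case
    using monomial by (rule_tac poly_fun_degree_mono) simp_all
next
  case (add F G)
  then show ?case
    by (intro poly_fun.add)
qed

lemma poly_fun_supported_expansion:
  assumes "poly_fun d F"
  shows "\<exists>c. \<forall>Z\<in>supported_in N. F Z = (\<Sum>m\<in>monomials_upto N d. c m * monomial m Z)"
  using assms
proof induction
  case (monomial m a)
  have "a * monomial m Z = (\<Sum>n\<in>monomials_upto N d. (if n = m then a else 0) * monomial n Z)"
    if Z: "Z \<in> supported_in N" for Z
  proof (cases "set_mset m \<subseteq> box N")
    case True
    with monomial have "m \<in> monomials_upto N d"
      by (simp add: monomials_upto_def)
    then show ?thesis
      by (simp add: if_distrib[of "\<lambda>x. x * _"] cong: if_cong)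
  next
    case False
    then have "m \<notin> monomials_upto N d"
      by (simp add: monomials_upto_def)
    then show ?thesis
      using monomial_supported_zero[OF Z False] 
      by (simp add: if_distrib[of "\<lambda>x. x * _"] cong: if_cong)
  qed
  then show ?case
    by (intro exI[of _ "\<lambda>n. if n = m then a else 0"]) blast
next
  case (add F G)
  then obtain a b where
    "\<forall>Z\<in>supported_in N. F Z = (\<Sum>m\<in>monomials_upto N d. a m * monomial m Z)"
    "\<forall>Z\<in>supported_in N. G Z = (\<Sum>m\<in>monomials_upto N d. b m * monomial m Z)"
    by blast
  then show ?case
    by (intro exI[of _ "\<lambda>m. a m + b m"]) (simp add: distrib_right sum.distrib)
qed

lemma eval_series_boxwise_poly_fun:
  fixes f :: "'k::comm_ring_1 power_series"
  assumes "\<And>m. f m \<noteq> 0 \<Longrightarrow> size m \<le> d"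
  shows "\<exists>F. poly_fun d F \<and> (\<forall>Z\<in>supported_in N. eval_series f Z = F Z)"
proof (intro exI conjI ballI)
  show "poly_fun d (\<lambda>Z. \<Sum>m\<in>monomials_upto N d. f m * monomial m Z)"
    by (intro poly_fun_sum poly_fun.monomial) (simp add: monomials_upto_def)
qed (rule eval_series_supported[OF assms])

text \<open>
  The expansions on growing boxes agree by uniqueness of coefficients, so they glue to one power
  series; the common degree bound makes it one of finite degree.
\<close>

lemma boxwise_poly_fun_eval_series:
  fixes \<phi> :: "'k::field plane \<Rightarrow> 'k"
  assumes inf: "infinite (UNIV :: 'k set)"
    and boxwise: "\<And>N. \<exists>F. poly_fun d F \<and> (\<forall>Z\<in>supported_in N. \<phi> Z = F Z)"
  shows "\<exists>f. finite_degree f \<and> (\<forall>Z\<in>evZ. \<phi> Z = eval_series f Z)"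
proof -
  have "\<exists>c. \<forall>Z\<in>supported_in N. \<phi> Z = (\<Sum>m\<in>monomials_upto N d. c m * monomial m Z)" for N
    using boxwise[of N] poly_fun_supported_expansion[of d _ N] by metis
  then obtain c where c: "\<And>N Z. Z \<in> supported_in N \<Longrightarrow>
      \<phi> Z = (\<Sum>m\<in>monomials_upto N d. c N m * monomial m Z)"
    by metis
  have coherent: "c N m = c M m" if "N \<le> M" "m \<in> monomials_upto N d" for N M m
  proof (rule supported_coefficients_unique[OF inf _ that(2), where c = "c N" and c' = "c M"])
    fix Z :: "'k plane"
    assume Z: "Z \<in> supported_in N"
    have "(\<Sum>m\<in>monomials_upto M d. c M m * monomial m Z)
        = (\<Sum>m\<in>monomials_upto N d. c M m * monomial m Z)"
    proof (rule sum.mono_neutral_right)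
      show "monomials_upto N d \<subseteq> monomials_upto M d"
        using box_mono[OF that(1)] by (auto simp: monomials_upto_def)
      show "\<forall>m\<in>monomials_upto M d - monomials_upto N d. c M m * monomial m Z = 0"
        using monomial_supported_zero[OF Z] by (auto simp: monomials_upto_def)
    qed simp
    then show "(\<Sum>m\<in>monomials_upto N d. c N m * monomial m Z)
        = (\<Sum>m\<in>monomials_upto N d. c M m * monomial m Z)"
      using c[OF Z] c[of Z M] supported_in_mono[OF that(1)] Z by auto
  qed
  define bd where "bd m = (SOME N. set_mset m \<subseteq> box N)" for m :: "(nat \<times> nat) multiset"
  have bd: "set_mset m \<subseteq> box (bd m)" for m
    unfolding bd_def by (rule someI_ex) (meson finite_set_mset finite_set_subset_box)
  define f where "f m = (if size m \<le> d then c (bd m) m else 0)" for m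
  have f_deg: "size m \<le> d" if "f m \<noteq> 0" for m
    using that by (simp add: f_def split: if_splits)
  have f: "f m = c N m" if "m \<in> monomials_upto N d" for m N
  proof -
    have "m \<in> monomials_upto (bd m) d"
      using that bd[of m] by (simp add: monomials_upto_def)
    with that have "c (bd m) m = c N m"
      by (metis coherent linorder_linear)
    with that show ?thesis
      by (simp add: f_def monomials_upto_def)
  qed
  show ?thesis
  proof (intro exI conjI ballI)
    show "finite_degree f"
      using f_deg by (auto simp: finite_degree_def)
    fix Z :: "'k plane"
    assume "Z \<in> evZ"
    then obtain N where Z: "Z \<in> supported_in N"
      by (rule evZ_supported)
    show "\<phi> Z = eval_series f Z"
      by (simp add: c[OF Z] eval_series_supported[OF f_deg Z] f)
  qed
qed

text \<open>
Both passages between a function and its differences are linear, but summation uses infinitely many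
variables in each coordinate. It is therefore enough to ask for linearity on each box separately.
\<close>

lemma eval_series_substitute:
  fixes f :: "'k::field power_series" and L :: "'k plane \<Rightarrow> 'k plane"
  assumes inf: "infinite (UNIV :: 'k set)"
    and f: "finite_degree f"
    and L_box: "\<And>N Z. Z \<in> supported_in N \<Longrightarrow> L Z \<in> supported_in N"
    and L_lin: "\<And>N. \<exists>L'. (\<forall>i. poly_fun 1 (\<lambda>Z. L' Z i)) \<and> (\<forall>Z\<in>supported_in N. L Z = L' Z)"
  shows "\<exists>g. finite_degree g \<and> (\<forall>Z\<in>evZ. eval_series f (L Z) = eval_series g Z)"
proof -
  from f obtain d where d: "\<And>m. f m \<noteq> 0 \<Longrightarrow> size m \<le> d"
    unfolding finite_degree_def by blast
  have boxwise: "\<exists>F. poly_fun d F \<and> (\<forall>Z\<in>supported_in N. eval_series f (L Z) = F Z)" for N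
  proof -
    obtain F where F: "poly_fun d F" "\<And>Z. Z \<in> supported_in N \<Longrightarrow> eval_series f Z = F Z"
      using eval_series_boxwise_poly_fun[of f d N] d by blast
    obtain L' where L': "\<And>i. poly_fun 1 (\<lambda>Z. L' Z i)" "\<And>Z. Z \<in> supported_in N \<Longrightarrow> L Z = L' Z"
      using L_lin by metis
    have "poly_fun d (\<lambda>Z. F (L' Z))"
      by (rule poly_fun_substitute[OF F(1), of L']) (rule L'(1))
    moreover have "eval_series f (L Z) = F (L' Z)" if "Z \<in> supported_in N" for Z
      using F(2)[OF L_box[OF that]] L'(2)[OF that] by simp
    ultimately show ?thesis
      by blast
  qed
  show ?thesis
    by (rule boxwise_poly_fun_eval_series[OF inf, where \<phi> = "\<lambda>Z. eval_series f (L Z)"])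
      (rule boxwise)
qed

section \<open>The difference operator and its inverse\<close>

text \<open>
Summation over the upper right quadrant of each point. On functions of finite support it is the right
inverse of \<^const>\<open>delta\<close> with values of finite support. The restriction to non-zero terms makes the sum finite.
\<close>

definition integ :: "'k::comm_ring_1 plane \<Rightarrow> 'k plane" where
  "integ Z = (\<lambda>(i, j). \<Sum>p | Z p \<noteq> 0 \<and> (i, j) \<le> p. Z p)"

lemma integ_supported:
  assumes "Z \<in> supported_in N"
  shows "integ Z (i, j) = (\<Sum>i'=i..<N. \<Sum>j'=j..<N. Z (i', j'))"
proof -
  have "integ Z (i, j) = (\<Sum>p\<in>{i..<N} \<times> {j..<N}. Z p)"
    unfolding integ_def prod.case using assms
    by (intro sum.mono_neutral_left) (force simp: supported_in_def box_def)+
  then show ?thesis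
    by (simp add: sum.cartesian_product)
qed

lemma integ_supported_in:
  assumes "Z \<in> supported_in N"
  shows "integ Z \<in> supported_in N"
  unfolding supported_in_def
proof safe
  fix i j
  assume "(i, j) \<notin> box N"
  then have "{i..<N} = {} \<or> {j..<N} = {}"
    by (auto simp: box_def)
  then show "integ Z (i, j) = 0"
    by (auto simp: integ_supported[OF assms])
qed

lemma integ_evC:
  assumes "Z \<in> evZ"
  shows "integ Z \<in> evC"
proof -
  from assms obtain N where "Z \<in> supported_in N"
    by (rule evZ_supported)
  then have "integ Z \<in> evZ"
    using integ_supported_in supported_in_evZ by blast
  then show ?thesis
    by (simp add: evZ_def)
qed

lemma integ_linear:
  "\<exists>L :: 'k::comm_ring_1 plane \<Rightarrow> 'k plane. (\<forall>i. poly_fun 1 (\<lambda>Z. L Z i)) \<and> (\<forall>Z\<in>supported_in N. integ Z = L Z)"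
proof (intro exI conjI allI ballI)
  let ?L = "\<lambda>Z :: 'k plane. \<lambda>p. \<Sum>i'=fst p..<N. \<Sum>j'=snd p..<N. 1 * monomial {#(i', j')#} Z"
  show "poly_fun 1 (\<lambda>Z. ?L Z p)" for p
    by (rule poly_fun_sum, rule poly_fun_sum, rule poly_fun.monomial) simp
  show "integ Z = ?L Z" if "Z \<in> supported_in N" for Z :: "'k plane"
    by (auto simp: fun_eq_iff integ_supported[OF that])
qed

lemma delta_integ:
  assumes "Z \<in> evZ"
  shows "delta (integ Z) = Z"
proof (rule ext, safe)
  fix i j
  from assms obtain N where Z: "Z \<in> supported_in N"
    by (rule evZ_supported)
  \<comment> \<open>The double sum telescopes, first along each row and then along the column of the results.\<close>
  have rowsum: "(\<Sum>j'=j..<N. Z (i', j')) - (\<Sum>j'=j+1..<N. Z (i', j')) = Z (i', j)" for i'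
    using Z by (cases "j < N") (simp_all add: sum.atLeast_Suc_lessThan supported_in_def box_def)
  have "delta (integ Z) (i, j) = (\<Sum>i'=i..<N. \<Sum>j'=j..<N. Z (i', j')) - (\<Sum>i'=i..<N. \<Sum>j'=j+1..<N. Z (i', j'))
      - ((\<Sum>i'=i+1..<N. \<Sum>j'=j..<N. Z (i', j')) - (\<Sum>i'=i+1..<N. \<Sum>j'=j+1..<N. Z (i', j')))"
    by (simp add: delta_def integ_supported[OF Z])
  also have "\<dots> = (\<Sum>i'=i..<N. Z (i', j)) - (\<Sum>i'=i+1..<N. Z (i', j))"
    by (simp only: sum_subtractf[symmetric] rowsum)
  also have "\<dots> = Z (i, j)"
    using Z by (cases "i < N") (simp_all add: sum.atLeast_Suc_lessThan supported_in_def box_def)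
  finally show "delta (integ Z) (i, j) = Z (i, j)" .
qed

text \<open>
Outside a large box the function is constant, and a vanishing difference determines the value at a
point from its three upper neighbours, so the constant spreads into the box from above.
\<close>

lemma delta_kernel:
  fixes X :: "'k::comm_ring_1 plane"
  assumes "X \<in> evC" "\<And>p. delta X p = 0"
  obtains c where "\<And>p. X p = c"
proof -
  from assms(1) obtain n1 n2 c where X: "\<And>p. \<not> p \<le> (n1, n2) \<Longrightarrow> X p = c"
    unfolding evC_def by fastforce
  have "X (i, j) = c" for i j
  proof (induction "(Suc n1 - i) + (Suc n2 - j)" arbitrary: i j rule: less_induct)
    case less
    show ?case
    proof (cases "(i, j) \<le> (n1, n2)")
      case True
      then have "X (i + 1, j + 1) = c" "X (i + 1, j) = c" "X (i, j + 1) = c"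
        by (auto intro!: less)
      with assms(2)[of "(i, j)"] show ?thesis
        by (simp add: delta_def)
    qed (rule X)
  qed
  then show thesis
    by (intro that[of c]) auto
qed

lemma delta_add_const: "delta (\<lambda>i. X i + c) = delta (X :: 'k::comm_ring_1 plane)"
  by (auto simp: delta_def algebra_simps)

lemma evC_diff:
  fixes X Y :: "'k::comm_ring_1 plane"
  assumes "X \<in> evC" "Y \<in> evC"
  shows "(\<lambda>i. X i - Y i) \<in> evC"
proof -
  from assms obtain m c n d where
    "\<And>i. \<not> i \<le> m \<Longrightarrow> X i = c" "\<And>i. \<not> i \<le> n \<Longrightarrow> Y i = d"
    unfolding evC_def by blast
  then have "\<forall>i. \<not> i \<le> sup m n \<longrightarrow> X i - Y i = c - d"
    by (metis le_supI1 le_supI2)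
  then show ?thesis
    unfolding evC_def by blast
qed

lemma evC_eq_integ_delta_plus_const:
  fixes X :: "'k::comm_ring_1 plane"
  assumes X: "X \<in> evC"
  obtains c where "X = (\<lambda>i. integ (delta X) i + c)"
proof -
  let ?Y = "integ (delta X)"
  have Y: "?Y \<in> evC"
    by (intro integ_evC delta_evZ X)
  have "delta (\<lambda>i. X i - ?Y i) p = delta X p - delta ?Y p" for p
    by (cases p) (simp add: delta_def)
  then have "delta (\<lambda>i. X i - ?Y i) p = 0" for p
    by (simp add: delta_integ delta_evZ X)
  then obtain c where "\<And>p. X p - ?Y p = c"
    using delta_kernel[OF evC_diff[OF X Y]] by blast
  then show thesis
    by (intro that[of c]) (auto simp: algebra_simps)
qed

lemma delta_supported_in:
  assumes "X \<in> supported_in N"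
  shows "delta X \<in> supported_in N"
  using assms by (auto simp: supported_in_def box_def delta_def)

lemma delta_linear: "poly_fun 1 (\<lambda>X :: 'k::comm_ring_1 plane. delta X p)"
proof -
  obtain i j where p: "p = (i, j)"
    by (cases p)
  have var: "poly_fun 1 (\<lambda>X :: 'k plane. a * monomial {#q#} X)" for a q
    by (rule poly_fun.monomial) simp
  have "poly_fun 1 (\<lambda>X :: 'k plane. (1 * monomial {#(i + 1, j + 1)#} X + (-1) * monomial {#(i + 1, j)#} X)
      + ((-1) * monomial {#(i, j + 1)#} X + 1 * monomial {#(i, j)#} X))"
    by (rule poly_fun.add; rule poly_fun.add; rule var)
  then show ?thesis
    by (simp add: p delta_def algebra_simps)
qed

section \<open>Warping is zero insertion\<close>

text \<open>
The strictly increasing map whose range omits exactly \<open>k\<close>; it makes room for a new row or column.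
\<close>

definition bump :: "nat \<Rightarrow> nat \<Rightarrow> nat" where
  "bump k i = (if i < k then i else Suc i)"

definition shift :: "nat \<Rightarrow> nat \<Rightarrow> nat \<times> nat \<Rightarrow> nat \<times> nat" where
  "shift a k = (if a = 1 then map_prod (bump k) id else map_prod id (bump k))"

text \<open>
Transport along \<open>h\<close>, filled up with zeros off its range. Along \<^term>\<open>shift a k\<close> this inserts a zero row
or a zero column at position \<open>k\<close>.
\<close>

definition push :: "('a \<Rightarrow> 'b) \<Rightarrow> ('a \<Rightarrow> 'k::zero) \<Rightarrow> 'b \<Rightarrow> 'k" where
  "push h Z p = (if p \<in> range h then Z (inv_into UNIV h p) else 0)"

lemma strict_mono_bump: "strict_mono (bump k)"
  by (auto simp: strict_mono_def bump_def)

lemma inj_bump: "inj (bump k)"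
  by (rule strict_mono_imp_inj_on[OF strict_mono_bump])

lemma inj_shift: "inj (shift a k)"
  by (simp add: shift_def prod.inj_map inj_bump)

lemma range_bump: "range (bump k) = - {k}"
proof -
  have "i \<in> range (bump k)" if "i \<noteq> k" for i
    using that by (intro range_eqI[of _ _ "if i < k then i else i - 1"]) (auto simp: bump_def)
  then show ?thesis
    by (auto simp: bump_def)
qed

lemma push_apply [simp]: "inj h \<Longrightarrow> push h Z (h p) = Z p"
  by (simp add: push_def)

text \<open>Row \<open>k\<close> of the warped function equals row \<open>k + 1\<close>, so its row \<open>k\<close> of differences vanishes.\<close>

lemma delta_warp:
  fixes X :: "'k::comm_ring_1 plane"
  assumes "a \<in> {1, 2}"
  shows "delta (warp a k X) = push (shift a k) (delta X)"
proof
  fix p :: "nat \<times> nat"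
  show "delta (warp a k X) p = push (shift a k) (delta X) p"
  proof (cases "p \<in> range (shift a k)")
    case True
    then obtain i j where p: "p = shift a k (i, j)"
      by auto
    have "delta (warp a k X) p = delta X (i, j)"
      using assms by (auto simp: p shift_def bump_def delta_def warp_def)
    then show ?thesis
      by (simp add: p inj_shift)
  next
    case False
    obtain i j where p: "p = (i, j)"
      by (cases p)
    have "range (shift a k) = (if a = 1 then (- {k}) \<times> UNIV else UNIV \<times> (- {k}))"
      by (simp add: shift_def map_prod_surj_on range_bump flip: UNIV_Times_UNIV)
    with False have "if a = 1 then i = k else j = k"
      by (auto simp: p split: if_splits)
    then have "delta (warp a k X) p = 0"
      using assms by (auto simp: p delta_def warp_def split: if_splits)
    with False show ?thesis
      by (simp add: push_def)
  qed
qed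

lemma monomial_push:
  assumes "inj h"
  shows "monomial (image_mset h m) (push h Z) = monomial m Z"
  by (simp add: multiset.map_comp comp_def assms)

lemma image_mset_inverse_on:
  assumes "set_mset m \<subseteq> range h"
  obtains m' where "m = image_mset h m'"
proof -
  have "image_mset h (image_mset (inv_into UNIV h) m) = image_mset (\<lambda>p. p) m"
    unfolding multiset.map_comp using assms by (intro image_mset_cong) (auto simp: f_inv_into_f)
  then show thesis
    by (intro that[of "image_mset (inv_into UNIV h) m"]) simp
qed

lemma monomial_push_zero:
  assumes "m \<notin> range (image_mset h)"
  shows "monomial m (push h Z) = 0"
proof -
  have "\<not> set_mset m \<subseteq> range h"
    using assms image_mset_inverse_on[of m h] by blast
  then show ?thesis
    by (auto intro: monomial_zero simp: push_def)
qed

lemma sum'_reindex: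
  assumes "bij_betw h S T"
  shows "sum' (\<lambda>x. g (h x)) S = sum' g T"
proof -
  have "bij_betw h {x \<in> S. g (h x) \<noteq> 0} {y \<in> T. g y \<noteq> 0}"
    using assms by (auto simp: bij_betw_def inj_on_def)
  then show ?thesis
    by (simp add: sum.G_def sum.reindex_bij_betw bij_betw_finite)
qed

text \<open>
Inserting zeros on the side of the argument amounts to relabelling the monomials on the side of the
coefficients: a monomial that uses one of the inserted positions vanishes.
\<close>

lemma eval_series_push:
  fixes f :: "'k::comm_semiring_1 power_series"
  assumes h: "inj h"
  shows "eval_series f (push h Z) = eval_series (f \<circ> image_mset h) Z"
proof -
  have "eval_series f (push h Z) = sum' (\<lambda>m. f m * monomial m (push h Z)) (range (image_mset h))"
    unfolding eval_series_def by (rule sum.mono_neutral_right') (auto simp: monomial_push_zero)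
  also have "\<dots> = sum' (\<lambda>m. f (image_mset h m) * monomial (image_mset h m) (push h Z)) UNIV"
    by (rule sum'_reindex[symmetric]) (simp add: bij_betw_def multiset.inj_map h)
  finally show ?thesis
    by (simp only: monomial_push[OF h] eval_series_def comp_def)
qed

section \<open>The composition of a monomial\<close>

definition row_indices :: "(nat \<times> nat) multiset \<Rightarrow> nat list" where
  "row_indices m = sorted_list_of_set (fst ` set_mset m)"

definition col_indices :: "(nat \<times> nat) multiset \<Rightarrow> nat list" where
  "col_indices m = sorted_list_of_set (snd ` set_mset m)"

text \<open>
Recording the exponents of a monomial as a matrix and deleting its zero rows and columns leaves a
composition; together with the deleted positions it determines the monomial.
\<close>

definition composition :: "(nat \<times> nat) multiset \<Rightarrow> nat mat" where
  "composition m = mat (length (row_indices m)) (length (col_indices m))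
     (\<lambda>(s, t). count m (row_indices m ! s, col_indices m ! t))"

lemma set_row_indices [simp]: "set (row_indices m) = fst ` set_mset m"
  by (simp add: row_indices_def)

lemma set_col_indices [simp]: "set (col_indices m) = snd ` set_mset m"
  by (simp add: col_indices_def)

lemma distinct_row_indices [simp]: "distinct (row_indices m)"
  by (simp add: row_indices_def)

lemma distinct_col_indices [simp]: "distinct (col_indices m)"
  by (simp add: col_indices_def)

lemma dim_composition [simp]:
  "dim_row (composition m) = length (row_indices m)" "dim_col (composition m) = length (col_indices m)"
  by (simp_all add: composition_def)

lemma index_composition [simp]:
  "s < length (row_indices m) \<Longrightarrow> t < length (col_indices m) \<Longrightarrow>
    composition m $$ (s, t) = count m (row_indices m ! s, col_indices m ! t)"
  by (simp add: composition_def)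

text \<open>
The empty composition fits the same description as the others, because a matrix with rows but no
columns, or columns but no rows, violates it. This removes the case distinction from what follows.
\<close>

lemma Cmp_iff:
  "A \<in> Cmp \<longleftrightarrow> (\<forall>s<dim_row A. \<exists>t<dim_col A. A $$ (s, t) \<noteq> 0) \<and>
    (\<forall>t<dim_col A. \<exists>s<dim_row A. A $$ (s, t) \<noteq> 0)" (is "_ \<longleftrightarrow> ?full")
proof -
  have row: "row A s \<noteq> 0\<^sub>v (dim_col A) \<longleftrightarrow> (\<exists>t<dim_col A. A $$ (s, t) \<noteq> 0)"
    if "s < dim_row A" for s
    using that by (auto simp: vec_eq_iff)
  have col: "col A t \<noteq> 0\<^sub>v (dim_row A) \<longleftrightarrow> (\<exists>s<dim_row A. A $$ (s, t) \<noteq> 0)"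
    if "t < dim_col A" for t
    using that by (auto simp: vec_eq_iff)
  have empty: "A = empty_comp \<longleftrightarrow> dim_row A = 0 \<and> dim_col A = 0"
    by (auto simp: empty_comp_def mat_eq_iff)
  have "?full \<Longrightarrow> dim_row A = 0 \<longleftrightarrow> dim_col A = 0"
    by (metis not_less0 gr0I)
  then show ?thesis
    unfolding Cmp_def using row col by (auto simp: empty Suc_le_eq)
qed

lemma composition_in_Cmp: "composition m \<in> Cmp"
proof -
  have "\<exists>t<length (col_indices m). count m (row_indices m ! s, col_indices m ! t) \<noteq> 0" if s: "s < length (row_indices m)" for s
  proof -
    have "row_indices m ! s \<in> fst ` set_mset m"
      using nth_mem[OF s] by simp
    then obtain j where j: "(row_indices m ! s, j) \<in># m"
      by force
    then have "j \<in> set (col_indices m)"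
      by force
    with j show ?thesis
      by (metis count_eq_zero_iff in_set_conv_nth)
  qed
  moreover have "\<exists>s<length (row_indices m). count m (row_indices m ! s, col_indices m ! t) \<noteq> 0"
    if t: "t < length (col_indices m)" for t
  proof -
    have "col_indices m ! t \<in> snd ` set_mset m"
      using nth_mem[OF t] by simp
    then obtain i where i: "(i, col_indices m ! t) \<in># m"
      by force
    then have "i \<in> set (row_indices m)"
      by force
    with i show ?thesis
      by (metis count_eq_zero_iff in_set_conv_nth)
  qed
  ultimately show ?thesis
    unfolding Cmp_iff by (metis dim_composition index_composition)
qed

lemma sum_over_grid:
  fixes h :: "'a \<times> 'b \<Rightarrow> 'c::comm_monoid_add"
  assumes "distinct xs" "distinct ys"
  shows "(\<Sum>p\<in>set xs \<times> set ys. h p) = (\<Sum>s<length xs. \<Sum>t<length ys. h (xs ! s, ys ! t))"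
proof -
  have "(\<Sum>p\<in>set xs \<times> set ys. h p) = (\<Sum>i\<in>set xs. \<Sum>j\<in>set ys. h (i, j))"
    by (simp add: sum.cartesian_product)
  then show ?thesis
    by (simp add: sum.reindex_bij_betw[OF bij_betw_nth[OF assms(1) refl refl], symmetric]
        sum.reindex_bij_betw[OF bij_betw_nth[OF assms(2) refl refl], symmetric])
qed

lemma prod_over_grid:
  fixes h :: "'a \<times> 'b \<Rightarrow> 'c::comm_monoid_mult"
  assumes "distinct xs" "distinct ys"
  shows "(\<Prod>p\<in>set xs \<times> set ys. h p) = (\<Prod>s<length xs. \<Prod>t<length ys. h (xs ! s, ys ! t))"
proof -
  have "(\<Prod>p\<in>set xs \<times> set ys. h p) = (\<Prod>i\<in>set xs. \<Prod>j\<in>set ys. h (i, j))"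
    by (simp add: prod.cartesian_product)
  then show ?thesis
    by (simp add: prod.reindex_bij_betw[OF bij_betw_nth[OF assms(1) refl refl], symmetric]
        prod.reindex_bij_betw[OF bij_betw_nth[OF assms(2) refl refl], symmetric])
qed

lemma support_in_grid: "set_mset m \<subseteq> set (row_indices m) \<times> set (col_indices m)"
  by force

lemma size_composition:
  "size m = (\<Sum>s<dim_row (composition m). \<Sum>t<dim_col (composition m). composition m $$ (s, t))"
proof -
  have "size m = (\<Sum>p\<in>set (row_indices m) \<times> set (col_indices m). count m p)"
    unfolding size_multiset_overloaded_eq
    by (rule sum.mono_neutral_left[OF _ support_in_grid]) (auto simp: not_in_iff)
  then show ?thesis
    by (simp add: sum_over_grid del: set_row_indices set_col_indices)
qed

lemma monomial_composition:
  "monomial m Z = (\<Prod>s<dim_row (composition m). \<Prod>t<dim_col (composition m).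
     Z (row_indices m ! s, col_indices m ! t) ^ (composition m $$ (s, t)))"
proof -
  have "monomial m Z = (\<Prod>p\<in>set (row_indices m) \<times> set (col_indices m). Z p ^ count m p)"
    unfolding image_prod_mset_multiplicity
    by (rule prod.mono_neutral_left[OF _ support_in_grid]) (auto simp: not_in_iff)
  then show ?thesis
    by (simp add: prod_over_grid del: set_row_indices set_col_indices)
qed

lemma count_image_mset_inj: "inj h \<Longrightarrow> count (image_mset h m) (h x) = count m x"
  by (induction m) (auto dest: injD)

lemma sorted_list_of_set_strict_mono_image:
  fixes f :: "nat \<Rightarrow> nat"
  assumes f: "strict_mono f" and S: "finite S"
  shows "sorted_list_of_set (f ` S) = map f (sorted_list_of_set S)"
proof (rule strict_sorted_equal)
  show "sorted_wrt (<) (map f (sorted_list_of_set S))"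
    using strict_sorted_list_of_set[of S] f
    by (simp add: sorted_wrt_map strict_mono_less)
qed (use S in simp_all)

text \<open>
The composition only sees the relative order of the occupied rows and columns.
\<close>

lemma composition_strict_mono_image:
  assumes f: "strict_mono f" and g: "strict_mono g"
  shows "composition (image_mset (map_prod f g) m) = composition m"
proof -
  let ?m = "image_mset (map_prod f g) m"
  have "fst ` set_mset ?m = f ` fst ` set_mset m" "snd ` set_mset ?m = g ` snd ` set_mset m"
    by force+
  then have "row_indices ?m = map f (row_indices m)" "col_indices ?m = map g (col_indices m)"
    by (simp_all add: row_indices_def col_indices_def sorted_list_of_set_strict_mono_image f g)
  moreover have "inj (map_prod f g)"
    by (intro prod.inj_map strict_mono_imp_inj_on f g)
  then have "count ?m (f i, g j) = count m (i, j)" for i j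
    using count_image_mset_inj[of "map_prod f g" m "(i, j)"] by simp
  ultimately show ?thesis
    by (intro eq_matI) simp_all
qed

lemma composition_shift: "composition (image_mset (shift a k) m) = composition m"
  using composition_strict_mono_image[OF strict_mono_bump strict_mono_id, of k m]
    composition_strict_mono_image[OF strict_mono_id strict_mono_bump, of k m]
  by (simp add: shift_def id_def)

section \<open>Removing the gaps of a monomial\<close>

text \<open>
A monomial is gap-free if its occupied rows and its occupied columns are initial segments. Each
composition belongs to exactly one gap-free monomial, the normal form modulo insertion of zeros.
\<close>

definition gap_free :: "(nat \<times> nat) multiset \<Rightarrow> bool" where
  "gap_free m \<longleftrightarrow> (\<exists>r. fst ` set_mset m = {..<r}) \<and> (\<exists>c. snd ` set_mset m = {..<c})"

lemma gap_in_finite_set: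
  fixes S :: "nat set"
  assumes "finite S" "\<nexists>r. S = {..<r}"
  obtains k i where "k \<notin> S" "i \<in> S" "k < i"
proof -
  \<comment> \<open>The least missing number: everything below it lies in the set, hence something above does too.\<close>
  define k where "k = (LEAST k. k \<notin> S)"
  have "\<exists>k. k \<notin> S"
    using assms(1) ex_new_if_finite infinite_UNIV_nat by blast
  then have k: "k \<notin> S"
    unfolding k_def by (rule LeastI_ex)
  have "{..<k} \<subseteq> S"
    unfolding k_def using not_less_Least by blast
  with assms(2) obtain i where "i \<in> S" "\<not> i < k"
    by blast
  with k show thesis
    by (intro that[of k i]) (metis nat_neq_iff)+
qed

text \<open>
The termination measure for closing gaps.
\<close>

definition weight :: "(nat \<times> nat) multiset \<Rightarrow> nat" where
  "weight m = (\<Sum>(i, j)\<in>#m. i + j)"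

lemma weight_image_less:
  assumes le: "\<And>i j. i + j \<le> fst (h (i, j)) + snd (h (i, j))"
    and p: "(i0, j0) \<in># m" "i0 + j0 < fst (h (i0, j0)) + snd (h (i0, j0))"
  shows "weight m < weight (image_mset h m)"
proof -
  have mono: "weight n \<le> weight (image_mset h n)" for n
    unfolding weight_def multiset.map_comp
    by (rule sum_mset_mono) (use le in \<open>auto simp: case_prod_beta\<close>)
  obtain n where m: "m = add_mset (i0, j0) n"
    using p(1) by (blast dest: multi_member_split)
  show ?thesis
    using p(2) mono[of n] by (auto simp: m weight_def case_prod_beta)
qed

lemma remove_gap:
  assumes "\<not> gap_free m"
  obtains a k m' where "a \<in> {1, 2}" "m = image_mset (shift a k) m'" "weight m' < weight m"
proof -
  consider (row) "\<nexists>r. fst ` set_mset m = {..<r}" | (col) "\<nexists>c. snd ` set_mset m = {..<c}"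
    using assms unfolding gap_free_def by blast
  then show thesis
  proof cases
    case row
    then obtain k i where k: "k \<notin> fst ` set_mset m" and i: "i \<in> fst ` set_mset m" "k < i"
      using gap_in_finite_set[of "fst ` set_mset m"] by blast
    have "range (shift 1 k) = (- {k}) \<times> UNIV"
      by (simp add: shift_def map_prod_surj_on range_bump flip: UNIV_Times_UNIV)
    with k have "set_mset m \<subseteq> range (shift 1 k)"
      by force
    then obtain m' where m': "m = image_mset (shift 1 k) m'"
      by (rule image_mset_inverse_on)
    from i obtain i' j' where "(i', j') \<in># m'" "bump k i' = i"
      by (auto simp: m' shift_def)
    with i(2) have "weight m' < weight m"
      unfolding m' by (intro weight_image_less) (auto simp: shift_def bump_def split: if_splits)
    with m' show thesis
      by (intro that[of 1 k m']) simp_all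
  next
    case col
    then obtain k j where k: "k \<notin> snd ` set_mset m" and j: "j \<in> snd ` set_mset m" "k < j"
      using gap_in_finite_set[of "snd ` set_mset m"] by blast
    have "range (shift 2 k) = UNIV \<times> (- {k})"
      by (simp add: shift_def map_prod_surj_on range_bump flip: UNIV_Times_UNIV)
    with k have "set_mset m \<subseteq> range (shift 2 k)"
      by force
    then obtain m' where m': "m = image_mset (shift 2 k) m'"
      by (rule image_mset_inverse_on)
    from j obtain i' j' where "(i', j') \<in># m'" "bump k j' = j"
      by (auto simp: m' shift_def)
    with j(2) have "weight m' < weight m"
      unfolding m' by (intro weight_image_less) (auto simp: shift_def bump_def split: if_splits)
    with m' show thesis
      by (intro that[of 2 k m']) simp_all
  qed
qed

text \<open>
Closing one gap at a time stays within the class of monomials on which \<open>g\<close> is constant and keeps the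
composition, and it lowers the weight until no gap is left.
\<close>

lemma gap_free_representative:
  assumes g: "\<And>a k m. a \<in> {1, 2} \<Longrightarrow> g (image_mset (shift a k) m) = g m"
  obtains n where "gap_free n" "composition n = composition m" "g n = g m"
proof -
  have "\<exists>n. gap_free n \<and> composition n = composition m \<and> g n = g m"
  proof (induction "weight m" arbitrary: m rule: less_induct)
    case less
    show ?case
    proof (cases "gap_free m")
      case False
      then obtain a k m' where a: "a \<in> {1, 2}" and m: "m = image_mset (shift a k) m'"
        and "weight m' < weight m"
        by (rule remove_gap)
      from less[OF this(3)] show ?thesis
        by (simp add: m g[OF a] composition_shift)
    qed blast
  qed
  then show thesis
    using that by blast
qed

lemma gap_free_determined:
  assumes "gap_free m" "gap_free n" and eq: "composition m = composition n"
  shows "m = n"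
proof -
  have entry: "count p (i, j) = (if i < dim_row (composition p) \<and> j < dim_col (composition p)
      then composition p $$ (i, j) else 0)" if gf: "gap_free p" for p i j
  proof -
    obtain r c where rc: "fst ` set_mset p = {..<r}" "snd ` set_mset p = {..<c}"
      using gf unfolding gap_free_def by blast
    then have row_indices: "row_indices p = [0..<r]" "col_indices p = [0..<c]"
      by (simp_all add: row_indices_def col_indices_def flip: atLeast0LessThan)
    have "(i, j) \<notin># p" if "\<not> (i < r \<and> j < c)"
      using that rc by (metis fst_conv imageI lessThan_iff snd_conv)
    then show ?thesis
      by (auto simp: row_indices not_in_iff)
  qed
  show ?thesis
  proof (rule multiset_eqI)
    show "count m p = count n p" for p
      using entry[OF assms(1)] entry[OF assms(2)] eq by (cases p) simp
  qed
qed

text \<open>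
A gap-free monomial occupies at most as many rows, and as many columns, as its degree. Hence there
are only finitely many of bounded degree, which is what makes the linear combination finite.
\<close>

lemma gap_free_in_box:
  assumes "gap_free m"
  shows "set_mset m \<subseteq> box (size m)"
proof -
  have card: "card (h ` set_mset m) \<le> size m" for h :: "nat \<times> nat \<Rightarrow> nat"
  proof -
    have "card (set_mset m) = (\<Sum>p\<in>set_mset m. 1)"
      by simp
    also have "\<dots> \<le> size m"
      unfolding size_multiset_overloaded_eq by (rule sum_mono) (simp add: Suc_le_eq)
    finally show ?thesis
      using card_image_le[of "set_mset m" h] by simp
  qed
  obtain r c where rc: "fst ` set_mset m = {..<r}" "snd ` set_mset m = {..<c}"
    using assms unfolding gap_free_def by blast
  then have "set_mset m \<subseteq> {..<r} \<times> {..<c}"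
    by force
  moreover have "r \<le> size m" "c \<le> size m"
    using card[of fst] card[of snd] by (simp_all add: rc)
  ultimately show ?thesis
    unfolding box_def by (meson Sigma_mono lessThan_subset_iff order_trans)
qed

section \<open>The sums signature as a power series\<close>

lemma sorted_list_of_set_strict_sorted:
  fixes xs :: "nat list"
  assumes "sorted_wrt (<) xs"
  shows "sorted_list_of_set (set xs) = xs"
  using assms by (simp add: strict_sorted_equal)

lemma increasing_tuplesD:
  assumes "\<iota> \<in> increasing_tuples r"
  shows "length \<iota> = r" "distinct \<iota>" "sorted_list_of_set (set \<iota>) = \<iota>"
  using assms
  by (auto simp: increasing_tuples_def sorted_list_of_set_strict_sorted strict_sorted_iff)

lemma row_col_indices_increasing:
  "row_indices m \<in> increasing_tuples (dim_row (composition m))"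
  "col_indices m \<in> increasing_tuples (dim_col (composition m))"
  unfolding increasing_tuples_def row_indices_def col_indices_def composition_def by simp_all

text \<open>
Distributing the entries of \<open>A\<close> onto the rows \<open>\<iota>\<close> and columns \<open>\<kappa>\<close> inverts the passage to the
composition. As \<open>A\<close> has neither zero rows nor zero columns, all these rows and columns are occupied.
\<close>

lemma monomial_at_positions:
  assumes A: "A \<in> Cmp"
    and \<iota>: "\<iota> \<in> increasing_tuples (dim_row A)" and \<kappa>: "\<kappa> \<in> increasing_tuples (dim_col A)"
  obtains m where "composition m = A" "row_indices m = \<iota>" "col_indices m = \<kappa>"
proof -
  define m where "m = (\<Sum>s<dim_row A. \<Sum>t<dim_col A. replicate_mset (A $$ (s, t)) (\<iota> ! s, \<kappa> ! t))"
  note i = increasing_tuplesD[OF \<iota>] and k = increasing_tuplesD[OF \<kappa>]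
  have count: "count m (\<iota> ! s, \<kappa> ! t) = A $$ (s, t)" if "s < dim_row A" "t < dim_col A" for s t
  proof -
    have "count m (\<iota> ! s, \<kappa> ! t) = (\<Sum>s'<dim_row A. \<Sum>t'<dim_col A.
        if s' = s then if t' = t then A $$ (s', t') else 0 else 0)"
      unfolding m_def count_sum
      by (intro sum.cong refl) (use that i k in \<open>auto simp: nth_eq_iff_index_eq\<close>)
    also have "\<dots> = A $$ (s, t)"
      using that by (simp add: sum.If_cases if_distrib[of "sum _"] cong: if_cong)
    finally show ?thesis .
  qed
  have support: "set_mset m = {(\<iota> ! s, \<kappa> ! t) | s t. s < dim_row A \<and> t < dim_col A \<and> A $$ (s, t) \<noteq> 0}"
    unfolding m_def by (auto simp: set_mset_sum split: if_splits)
  have full: "\<And>s. s < dim_row A \<Longrightarrow> \<exists>t<dim_col A. A $$ (s, t) \<noteq> 0"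
    "\<And>t. t < dim_col A \<Longrightarrow> \<exists>s<dim_row A. A $$ (s, t) \<noteq> 0"
    using A unfolding Cmp_iff by blast+
  have "fst ` set_mset m = set \<iota>"
    unfolding support set_conv_nth i(1) using full(1) by (auto simp: image_iff) blast
  then have rows: "row_indices m = \<iota>"
    by (simp add: row_indices_def i)
  have "snd ` set_mset m = set \<kappa>"
    unfolding support set_conv_nth k(1) using full(2) by (auto simp: image_iff) blast
  then have cols: "col_indices m = \<kappa>"
    by (simp add: col_indices_def k)
  have "composition m = A"
    by (rule eq_matI) (simp_all add: composition_def rows cols i k count)
  from this rows cols show thesis
    by (rule that)
qed

lemma composition_fibre_bij:
  assumes "A \<in> Cmp"
  shows "bij_betw (\<lambda>m. (row_indices m, col_indices m)) {m. composition m = A}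
    (increasing_tuples (dim_row A) \<times> increasing_tuples (dim_col A))"
proof (rule bij_betw_imageI)
  show "inj_on (\<lambda>m. (row_indices m, col_indices m)) {m. composition m = A}"
  proof (rule inj_onI, clarsimp)
    fix m n
    assume eq: "composition m = composition n" "row_indices n = row_indices m" "col_indices n = col_indices m"
    show "n = m"
    proof (rule multiset_eqI)
      fix p :: "nat \<times> nat"
      obtain i j where p: "p = (i, j)"
        by (cases p)
      show "count n p = count m p"
      proof (cases "p \<in> set (row_indices m) \<times> set (col_indices m)")
        case True
        then obtain s t where "s < length (row_indices m)" "i = row_indices m ! s"
          "t < length (col_indices m)" "j = col_indices m ! t"
          unfolding p mem_Sigma_iff in_set_conv_nth by blast
        then show ?thesis
          using eq index_composition[of s m t] index_composition[of s n t] by (simp add: p)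
      next
        case False
        then have "p \<notin># m" "p \<notin># n"
          using support_in_grid[of m] support_in_grid[of n] eq by (metis subsetD)+
        then show ?thesis
          by (simp add: not_in_iff)
      qed
    qed
  qed
  show "(\<lambda>m. (row_indices m, col_indices m)) ` {m. composition m = A}
      = increasing_tuples (dim_row A) \<times> increasing_tuples (dim_col A)"
  proof (intro equalityI subsetI)
    fix p
    assume "p \<in> increasing_tuples (dim_row A) \<times> increasing_tuples (dim_col A)"
    then obtain m where "composition m = A" "p = (row_indices m, col_indices m)"
      using monomial_at_positions[OF assms] by (metis SigmaE)
    then show "p \<in> (\<lambda>m. (row_indices m, col_indices m)) ` {m. composition m = A}"
      by blast
  qed (use row_col_indices_increasing in blast)
qed

text \<open>
The pairs of increasing tuples that index the sum are precisely the possible positions of a monomial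
with composition \<open>A\<close>.
\<close>

lemma SS_eq_sum_monomials:
  assumes "A \<in> Cmp"
  shows "SS Z A = sum' (\<lambda>m. monomial m Z) {m. composition m = A}"
proof -
  let ?term = "\<lambda>(\<iota>, \<kappa>). \<Prod>s<dim_row A. \<Prod>t<dim_col A. Z (\<iota> ! s, \<kappa> ! t) ^ (A $$ (s, t))"
  have "increasing_tuples 0 = {[]}"
    by (auto simp: increasing_tuples_def)
  then have "SS Z A = sum' ?term (increasing_tuples (dim_row A) \<times> increasing_tuples (dim_col A))"
    by (simp add: SS_def empty_comp_def)
  also have "\<dots> = sum' (\<lambda>m. ?term (row_indices m, col_indices m)) {m. composition m = A}"
    by (rule sum'_reindex[OF composition_fibre_bij[OF assms], symmetric])
  also have "\<dots> = sum' (\<lambda>m. monomial m Z) {m. composition m = A}"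
    by (rule sum.cong') (auto simp: monomial_composition)
  finally show ?thesis .
qed

lemma finite_degree_lookup_composition:
  "finite_degree (\<lambda>m. Poly_Mapping.lookup w (composition m))"
  unfolding finite_degree_def
proof (intro exI allI impI)
  fix m
  assume "Poly_Mapping.lookup w (composition m) \<noteq> 0"
  then have "composition m \<in> Poly_Mapping.keys w"
    by (simp add: in_keys_iff)
  then show "size m \<le> (\<Sum>A\<in>Poly_Mapping.keys w. \<Sum>s<dim_row A. \<Sum>t<dim_col A. A $$ (s, t))"
    unfolding size_composition[of m] by (rule member_le_sum) simp_all
qed

text \<open>
This identifies the linear combinations of the coefficients of the signature with the series whose
coefficient at a monomial depends only on its composition.
\<close>

lemma SS_lin_eq_eval_series:
  fixes w :: "nat mat \<Rightarrow>\<^sub>0 'k::comm_ring_1"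
  assumes w: "Poly_Mapping.keys w \<subseteq> Cmp" and "Z \<in> evZ"
  shows "SS_lin Z w = eval_series (\<lambda>m. Poly_Mapping.lookup w (composition m)) Z"
proof -
  obtain d where d: "\<And>m. Poly_Mapping.lookup w (composition m) \<noteq> 0 \<Longrightarrow> size m \<le> d"
    using finite_degree_lookup_composition[of w] unfolding finite_degree_def by blast
  obtain N where Z: "Z \<in> supported_in N"
    using evZ_supported[OF assms(2)] .
  let ?M = "monomials_upto N d"
  let ?K = "{m \<in> ?M. composition m \<in> Poly_Mapping.keys w}"
  let ?h = "\<lambda>m. Poly_Mapping.lookup w (composition m) * monomial m Z"
  have SS: "Poly_Mapping.lookup w A * SS Z A = sum ?h {m \<in> ?K. composition m = A}"
    if A: "A \<in> Poly_Mapping.keys w" for A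
  proof -
    have zero: "monomial m Z = 0" if "composition m = A" "m \<notin> ?M" for m
      using that A d[of m] monomial_supported_zero[OF Z, of m]
      by (auto simp: monomials_upto_def in_keys_iff)
    have "SS Z A = sum' (\<lambda>m. monomial m Z) {m. composition m = A}"
      using A w by (intro SS_eq_sum_monomials) blast
    also have "\<dots> = sum' (\<lambda>m. monomial m Z) {m \<in> ?K. composition m = A}"
    proof (rule sum.mono_neutral_right')
      show "\<forall>m\<in>{m. composition m = A} - {m \<in> ?K. composition m = A}. monomial m Z = 0"
      proof
        fix m
        assume "m \<in> {m. composition m = A} - {m \<in> ?K. composition m = A}"
        with A show "monomial m Z = 0"
          by (intro zero) auto
      qed
    qed auto
    also have "\<dots> = sum (\<lambda>m. monomial m Z) {m \<in> ?K. composition m = A}"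
      by (rule sum.eq_sum) simp
    finally show ?thesis
      by (simp add: sum_distrib_left)
  qed
  have "SS_lin Z w = (\<Sum>A\<in>Poly_Mapping.keys w. sum ?h {m \<in> ?K. composition m = A})"
    unfolding SS_lin_def by (rule sum.cong) (simp_all add: SS)
  also have "\<dots> = sum ?h ?K"
    by (rule sum.group) auto
  also have "\<dots> = sum ?h ?M"
    by (rule sum.mono_neutral_left) (auto simp: in_keys_iff)
  also have "\<dots> = eval_series (\<lambda>m. Poly_Mapping.lookup w (composition m)) Z"
    by (rule eval_series_supported[symmetric, OF _ Z]) (rule d)
  finally show ?thesis .
qed

text \<open>
Monomials with the same composition have the same gap-free representative, so an invariant \<open>g\<close> is
constant on each class. Bounded degree leaves only finitely many classes with a non-zero value.
\<close>

lemma shift_invariant_series_factors: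
  fixes g :: "'k::zero power_series"
  assumes inv: "\<And>a k m. a \<in> {1, 2} \<Longrightarrow> g (image_mset (shift a k) m) = g m"
    and "finite_degree g"
  obtains w where "Poly_Mapping.keys w \<subseteq> Cmp" "\<And>m. g m = Poly_Mapping.lookup w (composition m)"
proof -
  from assms(2) obtain d where d: "\<And>m. g m \<noteq> 0 \<Longrightarrow> size m \<le> d"
    unfolding finite_degree_def by blast
  have same: "g m = g n" if "composition m = composition n" for m n
  proof -
    obtain m' n' where "gap_free m'" "composition m' = composition m" "g m' = g m"
      "gap_free n'" "composition n' = composition n" "g n' = g n"
      using gap_free_representative[of g m] gap_free_representative[of g n] inv by metis
    then show ?thesis
      using gap_free_determined that by metis
  qed
  define v where "v A = (if A \<in> range composition then g (SOME m. composition m = A) else 0)" for A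
  have v: "v (composition m) = g m" for m
    using same[OF someI[of "\<lambda>n. composition n = composition m" m]] by (simp add: v_def)
  have "{A. v A \<noteq> 0} \<subseteq> composition ` monomials_upto d d"
  proof
    fix A
    assume "A \<in> {A. v A \<noteq> 0}"
    then obtain m where m: "A = composition m" "g m \<noteq> 0"
      using v by (auto simp: v_def split: if_splits)
    obtain n where n: "gap_free n" "composition n = composition m" "g n = g m"
      using gap_free_representative[of g m] inv by metis
    with m d have "size n \<le> d"
      by metis
    with gap_free_in_box[OF n(1)] box_mono[of "size n" d] have "n \<in> monomials_upto d d"
      by (auto simp: monomials_upto_def)
    with m n show "A \<in> composition ` monomials_upto d d"
      by (metis imageI)
  qed
  then have fin: "finite {A. v A \<noteq> 0}"
    by (rule finite_subset) simp
  then have lookup: "Poly_Mapping.lookup (Abs_poly_mapping v) = v"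
    by (intro Abs_poly_mapping_inverse) simp
  have "A \<in> Cmp" if "v A \<noteq> 0" for A
    using that composition_in_Cmp by (auto simp: v_def split: if_splits)
  then have "Poly_Mapping.keys (Abs_poly_mapping v) \<subseteq> Cmp"
    by (auto simp: in_keys_iff lookup)
  then show thesis
    by (rule that) (simp add: lookup v)
qed

section \<open>Polynomial invariants\<close>

text \<open>
On functions of finite support, composing with the shift does not change the values of the series,
since insertion of zeros is the warping of the summed function. Over an infinite field equality of
values is equality of coefficients.
\<close>

lemma warp_invariant_series_shift_invariant:
  fixes g :: "'k::field power_series"
  assumes inf: "infinite (UNIV :: 'k set)"
    and g: "finite_degree g" "\<And>X. X \<in> evC \<Longrightarrow> \<psi> X = eval_series g (delta X)"
    and warp: "\<And>X. X \<in> evC \<Longrightarrow> \<psi> (warp a k X) = \<psi> X" and a: "a \<in> {1, 2}"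
  shows "g (image_mset (shift a k) m) = g m"
proof -
  have "g \<circ> image_mset (shift a k) = g"
  proof (rule eval_series_unique[OF inf _ g(1)])
    obtain d where "\<And>m. g m \<noteq> 0 \<Longrightarrow> size m \<le> d"
      using g(1) unfolding finite_degree_def by blast
    then have "(g \<circ> image_mset (shift a k)) m \<noteq> 0 \<Longrightarrow> size m \<le> d" for m
      by (metis comp_apply size_image_mset)
    then show "finite_degree (g \<circ> image_mset (shift a k))"
      unfolding finite_degree_def by blast
    fix Z :: "'k plane"
    assume Z: "Z \<in> evZ"
    let ?X = "integ Z"
    have X: "?X \<in> evC"
      by (rule integ_evC[OF Z])
    have "eval_series (g \<circ> image_mset (shift a k)) Z = eval_series g (push (shift a k) Z)"
      by (simp add: eval_series_push inj_shift)
    also have "\<dots> = \<psi> (warp a k ?X)"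
      by (simp add: g(2) warp_evC X delta_warp[OF a] delta_integ[OF Z])
    also have "\<dots> = eval_series g Z"
      by (simp add: warp X g(2) delta_integ[OF Z])
    finally show "eval_series (g \<circ> image_mset (shift a k)) Z = eval_series g Z" .
  qed
  then show ?thesis
    by (metis comp_apply)
qed

theorem theorem3p14:
  fixes \<psi> :: "'k::field plane \<Rightarrow> 'k"
  assumes "infinite (UNIV :: 'k set)"
  shows "polynomial_invariant \<psi> \<longleftrightarrow>
    (\<exists>w :: nat mat \<Rightarrow>\<^sub>0 'k. Poly_Mapping.keys w \<subseteq> Cmp \<and> (\<forall>X\<in>evC. \<psi> X = SS_lin (delta X) w))"
proof
  assume "polynomial_invariant \<psi>"
  then obtain f where const: "\<And>X c. X \<in> evC \<Longrightarrow> \<psi> (\<lambda>i. X i + c) = \<psi> X"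
    and warp: "\<And>a k X. a \<in> {1, 2} \<Longrightarrow> X \<in> evC \<Longrightarrow> \<psi> (warp a k X) = \<psi> X"
    and f: "finite_degree f" "\<And>X. X \<in> evZ \<Longrightarrow> \<psi> X = eval_series f X"
    unfolding polynomial_invariant_def by blast
  have "\<exists>g. finite_degree g \<and> (\<forall>Z\<in>evZ. eval_series f (integ Z) = eval_series g Z)"
    by (rule eval_series_substitute[OF assms f(1) integ_supported_in integ_linear])
  then obtain g where
    g: "finite_degree g" "\<And>Z. Z \<in> evZ \<Longrightarrow> eval_series f (integ Z) = eval_series g Z"
    by blast
  have \<psi>: "\<psi> X = eval_series g (delta X)" if X: "X \<in> evC" for X
  proof -
    have Z: "delta X \<in> evZ"
      by (rule delta_evZ[OF X])
    obtain c where c: "X = (\<lambda>i. integ (delta X) i + c)"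
      using evC_eq_integ_delta_plus_const[OF X] .
    obtain N where "delta X \<in> supported_in N"
      using evZ_supported[OF Z] .
    then have "integ (delta X) \<in> evZ"
      using integ_supported_in supported_in_evZ by blast
    then have "eval_series g (delta X) = \<psi> (integ (delta X))"
      by (simp add: f(2) g(2)[OF Z])
    also have "\<dots> = \<psi> (\<lambda>i. integ (delta X) i + c)"
      by (rule const[OF integ_evC[OF Z], symmetric])
    finally show ?thesis
      unfolding c[symmetric] by simp
  qed
  have "g (image_mset (shift a k) m) = g m" if "a \<in> {1, 2}" for a k m
    using warp_invariant_series_shift_invariant[OF assms g(1) \<psi> warp[OF that] that] .
  from shift_invariant_series_factors[OF this g(1)] obtain w
    where w: "Poly_Mapping.keys w \<subseteq> Cmp" "\<And>m. g m = Poly_Mapping.lookup w (composition m)"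
    by metis
  have "\<psi> X = SS_lin (delta X) w" if X: "X \<in> evC" for X
    by (simp add: SS_lin_eq_eval_series[OF w(1) delta_evZ[OF X]] \<psi>[OF X] flip: w(2))
  with w(1) show "\<exists>w. Poly_Mapping.keys w \<subseteq> Cmp \<and> (\<forall>X\<in>evC. \<psi> X = SS_lin (delta X) w)"
    by blast
next
  assume "\<exists>w. Poly_Mapping.keys w \<subseteq> Cmp \<and> (\<forall>X\<in>evC. \<psi> X = SS_lin (delta X) w)"
  then obtain w where w: "Poly_Mapping.keys w \<subseteq> Cmp" "\<And>X. X \<in> evC \<Longrightarrow> \<psi> X = SS_lin (delta X) w"
    by blast
  define g where "g m = Poly_Mapping.lookup w (composition m)" for m
  have \<psi>: "\<psi> X = eval_series g (delta X)" if X: "X \<in> evC" for X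
    by (simp add: w(2)[OF X] SS_lin_eq_eval_series[OF w(1) delta_evZ[OF X]] g_def[abs_def])
  have "finite_degree g"
    unfolding g_def[abs_def] by (rule finite_degree_lookup_composition)
  then have "\<exists>f. finite_degree f \<and> (\<forall>X\<in>evZ. eval_series g (delta X) = eval_series f X)"
  proof (rule eval_series_substitute[OF assms])
    show "\<exists>L. (\<forall>i. poly_fun 1 (\<lambda>X. L X i)) \<and>
        (\<forall>X\<in>supported_in N. delta X = (L X :: 'k plane))" for N
      by (intro exI[of _ delta] conjI allI delta_linear) simp
  qed (rule delta_supported_in)
  then obtain f where
    f: "finite_degree f" "\<And>X. X \<in> evZ \<Longrightarrow> eval_series g (delta X) = eval_series f X"
    by blast
  have shift: "g \<circ> image_mset (shift a k) = g" for a k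
    by (simp add: fun_eq_iff g_def composition_shift)
  show "polynomial_invariant \<psi>"
    unfolding polynomial_invariant_def
  proof (intro conjI ballI allI exI[of _ f])
    fix X c
    assume X: "X \<in> (evC :: 'k plane set)"
    from X obtain n x where "\<And>i. \<not> i \<le> n \<Longrightarrow> X i = x"
      unfolding evC_def by blast
    then have "(\<lambda>i. X i + c) \<in> evC"
      unfolding evC_def by (intro CollectI exI[of _ n] exI[of _ "x + c"]) simp
    with X show "\<psi> (\<lambda>i. X i + c) = \<psi> X"
      by (simp add: \<psi> delta_add_const)
  next
    fix a k X
    assume "a \<in> {1, 2 :: nat}" and X: "X \<in> (evC :: 'k plane set)"
    then show "\<psi> (warp a k X) = \<psi> X"
      by (simp add: \<psi>[OF X] \<psi>[OF warp_evC[OF X]] delta_warp eval_series_push inj_shift shift)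
  next
    show "finite_degree f"
      by (rule f)
    fix X
    assume "X \<in> (evZ :: 'k plane set)"
    then show "\<psi> X = eval_series f X"
      using \<psi>[of X] f(2)[of X] by (simp add: evZ_def)
  qed
qed

end
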